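(* Let $\Omega\subset\mathbb{R}^3$ be a bounded domain, placed in the smallest box $I=(0,l_1)\times(0,l_2)\times(0,l_3)$ as described in the context. Let $\phi=(\phi_1,\phi_2,\phi_3)\in\mathring{\mathsf D}_0(\Omega)$. Then for every $i\in\{1,2,3\}$ and all $0\le\alpha_i<\beta_i\le l_i$, with $\Omega_i=\{x\in\Omega\mid\alpha_i<x_i<\beta_i\}$, one has $\phi_i\in\mathsf L^2_0(\Omega_i)$.
   Context: $\Omega$ is a bounded domain (open connected set) in $\mathbb{R}^3$; no boundary regularity is assumed. $\Omega$ is translated so that it is contained in the rectangular cuboid $I=(0,l_1)\times(0,l_2)\times(0,l_3)$, $0<l_1,l_2,l_3<\infty$, with $I$ as small as possible. For a bounded open set $\omega\subset\mathbb{R}^3$, $\mathsf L^2_0(\omega)=\{\varphi\in\mathsf L^2(\omega)\mid\int_\omega\varphi\,\mathrm{d}x=0\}$; a function on $\Omega$ is said to belong to $\mathsf L^2_0(\omega)$, $\omega\subset\Omega$, if its restriction to $\omega$ does. $\mathsf D(\Omega)$ is the space of vector fields $\phi\in\mathsf L^2(\Omega)$ (with values in $\mathbb{R}^3$) whose weak divergence $\operatorname{div}\phi=\partial_1\phi_1+\partial_2\phi_2+\partial_3\phi_3$ belongs to $\mathsf L^2(\Omega)$. $\mathring{\mathsf D}(\Omega)$ is the closure in $\mathsf D(\Omega)$ of the smooth vector fields with compact support in $\Omega$, with respect to the graph norm $(|\phi|_{\mathsf L^2}^2+|\operatorname{div}\phi|_{\mathsf L^2}^2)^{1/2}$, and $\mathring{\mathsf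 D}_0(\Omega)=\{\phi\in\mathring{\mathsf D}(\Omega)\mid\operatorname{div}\phi=0\}$. *)

theory Defs
  imports "HOL-Analysis.Analysis"
begin

text \<open>Functions on a set \<open>S\<close> are represented by total functions of which only the values on \<open>S\<close>
  matter; elements of \<open>L\<^sup>2\<close> are represented by functions instead of classes of functions that agree
  almost everywhere.\<close>

definition L2 :: "'a::euclidean_space set \<Rightarrow> ('a \<Rightarrow> 'b::euclidean_space) set" where
  "L2 S = {f \<in> borel_measurable (lebesgue_on S). integrable (lebesgue_on S) (\<lambda>x. (norm (f x))\<^sup>2)}"

definition L2_norm :: "'a::euclidean_space set \<Rightarrow> ('a \<Rightarrow> 'b::euclidean_space) \<Rightarrow> real" where
  "L2_norm S f = sqrt (LINT x|lebesgue_on S. (norm (f x))\<^sup>2)"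

definition L2_0 :: "'a::euclidean_space set \<Rightarrow> ('a \<Rightarrow> real) set" where
  "L2_0 S = {f \<in> L2 S. (LINT x|lebesgue_on S. f x) = 0}"

text \<open>In finite dimensions, \<open>C\<^sup>k\<close> is equivalent to the existence of \<open>k\<close> successive directional
  derivatives of this form, all of them continuous.\<close>

primrec Ck :: "nat \<Rightarrow> ('a::euclidean_space \<Rightarrow> 'b::euclidean_space) \<Rightarrow> bool" where
  "Ck 0 f \<longleftrightarrow> continuous_on UNIV f"
| "Ck (Suc k) f \<longleftrightarrow>
    (\<forall>x. f differentiable (at x)) \<and> (\<forall>v. Ck k (\<lambda>x. frechet_derivative f (at x) v))"

definition smooth :: "('a::euclidean_space \<Rightarrow> 'b::euclidean_space) \<Rightarrow> bool" where
  "smooth f \<longleftrightarrow> (\<forall>k. Ck k f)"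

definition test_functions :: "'a::euclidean_space set \<Rightarrow> ('a \<Rightarrow> 'b::euclidean_space) set" where
  "test_functions S = {f. smooth f \<and> compact (closure {x. f x \<noteq> 0}) \<and> closure {x. f x \<noteq> 0} \<subseteq> S}"

definition grad :: "(real^'n \<Rightarrow> real) \<Rightarrow> real^'n \<Rightarrow> real^'n" where
  "grad f x = (\<chi> i. frechet_derivative f (at x) (axis i 1))"

text \<open>The integrals below are meaningful (the integrands are integrable) for \<open>\<phi>\<close> and \<open>g\<close> in \<open>L2 S\<close>,
  the only case in which this relation is used.\<close>

definition has_weak_div :: "(real^'n) set \<Rightarrow> (real^'n \<Rightarrow> real^'n) \<Rightarrow> (real^'n \<Rightarrow> real) \<Rightarrow> bool" where
  "has_weak_div S \<phi> g \<longleftrightarrow>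
    (\<forall>\<eta> \<in> test_functions S.
      (LINT x|lebesgue_on S. \<phi> x \<bullet> grad \<eta> x) = - (LINT x|lebesgue_on S. g x * \<eta> x))"

definition D_space :: "(real^'n) set \<Rightarrow> (real^'n \<Rightarrow> real^'n) set" where
  "D_space S = {\<phi> \<in> L2 S. \<exists>g \<in> L2 S. has_weak_div S \<phi> g}"

text \<open>For open \<open>S\<close> and \<open>\<phi>\<close> in \<open>D_space S\<close>, all admissible \<open>g\<close> agree almost everywhere on \<open>S\<close>.\<close>

definition weak_div :: "(real^'n) set \<Rightarrow> (real^'n \<Rightarrow> real^'n) \<Rightarrow> real^'n \<Rightarrow> real" where
  "weak_div S \<phi> = (SOME g. g \<in> L2 S \<and> has_weak_div S \<phi> g)"

definition graph_norm :: "(real^'n) set \<Rightarrow> (real^'n \<Rightarrow> real^'n) \<Rightarrow> real" where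
  "graph_norm S \<phi> = sqrt ((L2_norm S \<phi>)\<^sup>2 + (L2_norm S (weak_div S \<phi>))\<^sup>2)"

definition D_ring :: "(real^'n) set \<Rightarrow> (real^'n \<Rightarrow> real^'n) set" where
  "D_ring S =
    {\<phi> \<in> D_space S. \<forall>\<epsilon>>0. \<exists>\<psi> \<in> test_functions S. graph_norm S (\<lambda>x. \<phi> x - \<psi> x) < \<epsilon>}"

definition D_ring_0 :: "(real^'n) set \<Rightarrow> (real^'n \<Rightarrow> real^'n) set" where
  "D_ring_0 S = {\<phi> \<in> D_ring S. AE x in lebesgue_on S. weak_div S \<phi> x = 0}"

text \<open>Minimality among all open boxes with sides parallel to the axes, wherever they are placed.
  With \<open>l > 0\<close> it implies that \<open>S\<close> is nonempty.\<close>

definition smallest_box :: "(real^'n) set \<Rightarrow> real^'n \<Rightarrow> bool" where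
  "smallest_box S l \<longleftrightarrow>
    (\<forall>i. 0 < l $ i) \<and> S \<subseteq> box 0 l \<and> (\<forall>a b. S \<subseteq> box a b \<longrightarrow> box 0 l \<subseteq> box a b)"

end

theory Submission
  imports Defs
begin

text \<open>
  The field \<open>\<phi>\<close> is orthogonal to every gradient \<open>W\<close> of a bounded Lipschitz function \<open>w\<close>
  (\<open>D_ring_0_orthogonal\<close>). The function \<open>w x = max \<alpha> (min \<beta> (x $ i))\<close> has, off two hyperplanes, the
  gradient \<open>axis i 1\<close> for \<open>\<alpha> < x $ i < \<beta>\<close> and \<open>0\<close> elsewhere, so that the integral of \<open>\<phi> \<bullet> W\<close>
  over \<open>\<Omega>\<close> is that of \<open>\<phi>\<^sub>i\<close> over the slice.

  For a smooth field \<open>\<psi>\<close> with compact support in \<open>\<Omega>\<close>, the integral of \<open>\<psi> \<bullet> W\<close> is minus the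
  integral of \<open>div \<psi> * w\<close> (\<open>integral_by_parts\<close>). This holds because the integral of a directional
  derivative of a compactly supported Lipschitz function vanishes (\<open>integral_derivative_zero\<close>), by
  translation invariance of the Lebesgue measure and dominated convergence of difference quotients.
  It remains to see that \<open>div \<psi>\<close> is small in \<open>L\<^sup>2\<close> when \<open>\<psi>\<close> approximates \<open>\<phi>\<close> in the graph norm
  (\<open>div_smooth_le_weak_div_diff\<close>). Let \<open>g\<close> be the weak divergence of \<open>\<phi> - \<psi>\<close>. Since that of \<open>\<phi>\<close> is
  \<open>0\<close>, the function \<open>g + div \<psi>\<close> is orthogonal to all test functions. As \<open>div \<psi>\<close> is itself a test
  function, the Cauchy-Schwarz inequality gives that the norm of \<open>div \<psi>\<close> is at most that of \<open>g\<close>.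
  Thus neither cut-off functions nor the uniqueness of weak divergences are needed.
\<close>

section \<open>Square integrable functions\<close>

lemma L2_D:
  assumes "f \<in> L2 S"
  shows "f \<in> borel_measurable (lebesgue_on S)" "integrable (lebesgue_on S) (\<lambda>x. (norm (f x))\<^sup>2)"
  using assms by (auto simp: L2_def)

lemma L2_integrable_inner:
  assumes f: "f \<in> L2 S" and g: "g \<in> L2 S"
  shows "integrable (lebesgue_on S) (\<lambda>x. f x \<bullet> g x)"
proof (rule Bochner_Integration.integrable_bound)
  show "integrable (lebesgue_on S) (\<lambda>x. (norm (f x))\<^sup>2 + (norm (g x))\<^sup>2)"
    using L2_D(2)[OF f] L2_D(2)[OF g] by simp
  show "(\<lambda>x. f x \<bullet> g x) \<in> borel_measurable (lebesgue_on S)"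
    using L2_D(1)[OF f] L2_D(1)[OF g] by simp
  have "\<bar>f x \<bullet> g x\<bar> \<le> (norm (f x))\<^sup>2 + (norm (g x))\<^sup>2" for x
  proof -
    have "\<bar>f x \<bullet> g x\<bar> \<le> norm (f x) * norm (g x)" by (rule Cauchy_Schwarz_ineq2)
    also have "\<dots> \<le> 2 * norm (f x) * norm (g x)" by simp
    also have "\<dots> \<le> (norm (f x))\<^sup>2 + (norm (g x))\<^sup>2" by (rule sum_squares_bound)
    finally show ?thesis .
  qed
  then show "AE x in lebesgue_on S. norm (f x \<bullet> g x) \<le> norm ((norm (f x))\<^sup>2 + (norm (g x))\<^sup>2)"
    by simp
qed

lemma L2_norm_nonneg: "0 \<le> L2_norm S f"
  by (simp add: L2_norm_def)

lemma L2_norm_power2: "(L2_norm S f)\<^sup>2 = (LINT x|lebesgue_on S. (norm (f x))\<^sup>2)"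
  by (simp add: L2_norm_def)

lemma norm_diff_scaled_power2:
  fixes x y :: "'b::real_inner"
  shows "(norm (x - t *\<^sub>R y))\<^sup>2 = (norm x)\<^sup>2 - 2 * t * (x \<bullet> y) + t\<^sup>2 * (norm y)\<^sup>2"
  unfolding power2_norm_eq_inner
  by (simp add: inner_diff_left inner_diff_right inner_commute power2_eq_square algebra_simps)

lemma L2_diff_scaled:
  assumes f: "f \<in> L2 S" and g: "g \<in> L2 S"
  shows "(\<lambda>x. f x - t *\<^sub>R g x) \<in> L2 S"
  using L2_D[OF f] L2_D[OF g] L2_integrable_inner[OF f g]
  by (simp add: L2_def norm_diff_scaled_power2)

lemma L2_Cauchy_Schwarz:
  assumes f: "f \<in> L2 S" and g: "g \<in> L2 S"
  shows "\<bar>LINT x|lebesgue_on S. f x \<bullet> g x\<bar> \<le> L2_norm S f * L2_norm S g"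
proof -
  define A B C where "A = (L2_norm S f)\<^sup>2" and "B = (LINT x|lebesgue_on S. f x \<bullet> g x)"
    and "C = (L2_norm S g)\<^sup>2"
  \<comment> \<open>The squared norm of \<open>f - t g\<close> is a nonnegative quadratic polynomial in \<open>t\<close>.\<close>
  have quadratic: "0 \<le> A - 2 * t * B + t\<^sup>2 * C" for t
  proof -
    have "0 \<le> (LINT x|lebesgue_on S. (norm (f x - t *\<^sub>R g x))\<^sup>2)" by simp
    also have "\<dots> = A - 2 * t * B + t\<^sup>2 * C"
      using L2_D(2)[OF f] L2_D(2)[OF g] L2_integrable_inner[OF f g]
      by (simp add: norm_diff_scaled_power2 A_def B_def C_def L2_norm_power2)
    finally show ?thesis .
  qed
  have "B\<^sup>2 \<le> A * C"
  proof (cases "C = 0")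
    case True
    have "B = 0"
    proof (rule ccontr)
      assume "B \<noteq> 0"
      \<comment> \<open>The polynomial is then affine and takes the value \<open>-1\<close> at this point.\<close>
      then show False using quadratic[of "(A + 1) / (2 * B)"] True by simp
    qed
    then show ?thesis using True by simp
  next
    case False
    then have "C > 0" by (simp add: C_def)
    \<comment> \<open>The polynomial attains its minimum at \<open>B / C\<close>.\<close>
    then show ?thesis using quadratic[of "B / C"]
      by (simp add: field_simps power2_eq_square)
  qed
  then have "B\<^sup>2 \<le> (L2_norm S f * L2_norm S g)\<^sup>2"
    by (simp add: A_def C_def power_mult_distrib)
  then show ?thesis
    unfolding B_def by (rule abs_le_square_iff[THEN iffD2, THEN order_trans])
      (simp add: L2_norm_nonneg)
qed

lemma bounded_measurable_L2:
  assumes "S \<in> lmeasurable" and "f \<in> borel_measurable lebesgue" and "\<And>x. norm (f x) \<le> B"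
  shows "f \<in> L2 S"
proof -
  interpret finite_measure "lebesgue_on S"
    by (rule finite_measure_lebesgue_on) fact
  have meas: "f \<in> borel_measurable (lebesgue_on S)"
    using assms(2) by (rule measurable_restrict_space1)
  have "integrable (lebesgue_on S) (\<lambda>x. (norm (f x))\<^sup>2)"
    using meas by (intro integrable_const_bound[where B = "B\<^sup>2"])
      (auto intro!: power_mono assms(3))
  with meas show ?thesis by (simp add: L2_def)
qed

section \<open>Smooth functions with compact support\<close>

lemma Ck_bounded_linear:
  assumes "bounded_linear L"
  shows "Ck k f \<Longrightarrow> Ck k (\<lambda>x. L (f x))"
proof (induction k arbitrary: f)
  case 0
  then show ?case using assms by (simp add: bounded_linear.continuous_on)
next
  case (Suc k)
  have der: "((\<lambda>x. L (f x)) has_derivative (\<lambda>v. L (frechet_derivative f (at x) v))) (at x)" for x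
    using Suc.prems by (intro bounded_linear.has_derivative[OF assms])
      (simp add: frechet_derivative_works)
  then have "frechet_derivative (\<lambda>x. L (f x)) (at x) = (\<lambda>v. L (frechet_derivative f (at x) v))" for x
    by (rule frechet_derivative_at[symmetric])
  with der Suc show ?case by (auto simp: differentiable_def)
qed

lemma Ck_add: "Ck k f \<Longrightarrow> Ck k g \<Longrightarrow> Ck k (\<lambda>x. f x + g x)"
proof (induction k arbitrary: f g)
  case 0
  then show ?case by (simp add: continuous_on_add)
next
  case (Suc k)
  have der: "((\<lambda>x. f x + g x) has_derivative
      (\<lambda>v. frechet_derivative f (at x) v + frechet_derivative g (at x) v)) (at x)" for x
    using Suc.prems by (intro has_derivative_add) (simp_all add: frechet_derivative_works)
  then have "frechet_derivative (\<lambda>x. f x + g x) (at x) =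
      (\<lambda>v. frechet_derivative f (at x) v + frechet_derivative g (at x) v)" for x
    by (rule frechet_derivative_at[symmetric])
  with der Suc show ?case by (auto simp: differentiable_def)
qed

lemma Ck_zero: "Ck k (\<lambda>x. 0)"
  by (induction k) auto

lemma Ck_sum:
  assumes "\<And>j. j \<in> J \<Longrightarrow> Ck k (f j)"
  shows "Ck k (\<lambda>x. \<Sum>j\<in>J. f j x)"
  using assms by (induction J rule: infinite_finite_induct) (auto intro: Ck_zero Ck_add)

lemma test_function_Ck: "f \<in> test_functions S \<Longrightarrow> Ck k f"
  by (simp add: test_functions_def smooth_def)

lemma test_function_continuous: "f \<in> test_functions S \<Longrightarrow> continuous_on UNIV f"
  using test_function_Ck[of f S 0] by simp

lemma test_function_has_derivative:
  "f \<in> test_functions S \<Longrightarrow> (f has_derivative frechet_derivative f (at x)) (at x)"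
  using test_function_Ck[of f S 1] by (simp add: frechet_derivative_works)

lemma test_function_zero: "f \<in> test_functions S \<Longrightarrow> x \<notin> S \<Longrightarrow> f x = 0"
  using closure_subset[of "{x. f x \<noteq> 0}"] by (auto simp: test_functions_def)

lemma test_function_support_bounded:
  assumes "f \<in> test_functions S"
  obtains R where "\<And>x. f x \<noteq> 0 \<Longrightarrow> norm x \<le> R"
proof -
  have "bounded {x. f x \<noteq> 0}"
    using assms by (auto simp: test_functions_def intro: bounded_subset[OF compact_imp_bounded closure_subset])
  then show ?thesis using that by (auto simp: bounded_iff)
qed

lemma test_function_bounded:
  assumes f: "f \<in> test_functions S"
  obtains B where "\<And>x. norm (f x) \<le> B"
proof -
  have "compact (f ` closure {x. f x \<noteq> 0})"
    using f by (auto simp: test_functions_def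
      intro!: compact_continuous_image continuous_on_subset[OF test_function_continuous[OF f]])
  then obtain B where B: "\<And>y. y \<in> f ` closure {x. f x \<noteq> 0} \<Longrightarrow> norm y \<le> B"
    using compact_imp_bounded by (metis bounded_iff)
  have "norm (f x) \<le> max B 0" for x
    using B[of "f x"] closure_subset[of "{x. f x \<noteq> 0}"] by (cases "f x = 0") auto
  then show ?thesis by (rule that)
qed

lemma test_functionI_support:
  assumes f: "f \<in> test_functions S" and g: "smooth g"
    and supp: "\<And>x. x \<notin> closure {x. f x \<noteq> 0} \<Longrightarrow> g x = 0"
  shows "g \<in> test_functions S"
proof -
  have "closure {x. g x \<noteq> 0} \<subseteq> closure {x. f x \<noteq> 0}"
    using supp by (intro closure_minimal) auto
  moreover from this have "compact (closure {x. g x \<noteq> 0})"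
    using f compact_Int_closed[of "closure {x. f x \<noteq> 0}" "closure {x. g x \<noteq> 0}"]
    by (simp add: test_functions_def Int_absorb1)
  ultimately show ?thesis using f g by (auto simp: test_functions_def)
qed

lemma test_function_derivative_zero:
  assumes f: "f \<in> test_functions S" and x: "x \<notin> closure {x. f x \<noteq> 0}"
  shows "frechet_derivative f (at x) = (\<lambda>v. 0)"
proof -
  have "((\<lambda>x. 0) has_derivative (\<lambda>v. 0)) (at x)" by simp
  then have "(f has_derivative (\<lambda>v. 0)) (at x)"
    by (rule has_derivative_transform_within_open[where s = "- closure {x. f x \<noteq> 0}"])
      (use x closure_subset[of "{x. f x \<noteq> 0}"] in auto)
  then show ?thesis by (rule frechet_derivative_at[symmetric])
qed

lemma test_function_derivative:
  assumes f: "f \<in> test_functions S"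
  shows "(\<lambda>x. frechet_derivative f (at x) v) \<in> test_functions S"
proof (rule test_functionI_support[OF f])
  show "smooth (\<lambda>x. frechet_derivative f (at x) v)"
    unfolding smooth_def
  proof
    fix k
    show "Ck k (\<lambda>x. frechet_derivative f (at x) v)"
      using test_function_Ck[OF f, of "Suc k"] by simp
  qed
qed (simp add: test_function_derivative_zero[OF f])

lemma test_function_Lipschitz:
  fixes f :: "'a::euclidean_space \<Rightarrow> 'b::euclidean_space"
  assumes f: "f \<in> test_functions S"
  obtains C where "\<And>x y. norm (f x - f y) \<le> C * norm (x - y)"
proof -
  have "\<exists>B. \<forall>x. norm (frechet_derivative f (at x) b) \<le> B" for b
    using test_function_bounded[OF test_function_derivative[OF f, of b]] by metis
  then obtain B where B: "\<And>b x. norm (frechet_derivative f (at x) b) \<le> B b" by metis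
  have "norm (f x - f y) \<le> (\<Sum>b\<in>Basis. B b) * norm (x - y)" for x y
  proof (rule differentiable_bound[OF convex_UNIV])
    fix x
    show "(f has_derivative frechet_derivative f (at x)) (at x within UNIV)"
      using test_function_has_derivative[OF f] by simp
    have "onorm (frechet_derivative f (at x)) \<le> (\<Sum>b\<in>Basis. norm (frechet_derivative f (at x) b))"
      by (rule onorm_componentwise)
        (rule has_derivative_bounded_linear[OF test_function_has_derivative[OF f]])
    also have "\<dots> \<le> (\<Sum>b\<in>Basis. B b)" by (intro sum_mono B)
    finally show "onorm (frechet_derivative f (at x)) \<le> (\<Sum>b\<in>Basis. B b)" .
  qed auto
  then show ?thesis by (rule that)
qed

lemma continuous_lebesgue_measurable:
  fixes f :: "'a::euclidean_space \<Rightarrow> 'b::euclidean_space"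
  shows "continuous_on UNIV f \<Longrightarrow> f \<in> borel_measurable lebesgue"
  by (intro measurable_completion) (simp add: borel_measurable_continuous_onI)

lemma test_function_measurable:
  fixes f :: "'a::euclidean_space \<Rightarrow> 'b::euclidean_space"
  shows "f \<in> test_functions S \<Longrightarrow> f \<in> borel_measurable lebesgue"
  by (intro continuous_lebesgue_measurable test_function_continuous)

lemma test_function_L2:
  fixes f :: "'a::euclidean_space \<Rightarrow> 'b::euclidean_space"
  assumes "S \<in> lmeasurable" and "f \<in> test_functions S"
  shows "f \<in> L2 S"
  by (rule test_function_bounded[OF assms(2)],
      rule bounded_measurable_L2[OF assms(1) test_function_measurable[OF assms(2)]])

text \<open>The pointwise divergence \<open>\<partial>\<^sub>1\<psi>\<^sub>1 + \<dots> + \<partial>\<^sub>n\<psi>\<^sub>n\<close>, meaningful where \<open>\<psi>\<close> is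
  differentiable.\<close>

definition div_smooth :: "(real^'n \<Rightarrow> real^'n) \<Rightarrow> real^'n \<Rightarrow> real" where
  "div_smooth \<psi> x = (\<Sum>j\<in>UNIV. frechet_derivative \<psi> (at x) (axis j 1) $ j)"

lemma div_smooth_test_function:
  assumes \<psi>: "\<psi> \<in> test_functions S"
  shows "div_smooth \<psi> \<in> test_functions S"
proof (rule test_functionI_support[OF \<psi>])
  have "Ck k (\<lambda>x. \<Sum>j\<in>UNIV. frechet_derivative \<psi> (at x) (axis j 1) $ j)" for k
    by (intro Ck_sum Ck_bounded_linear[OF bounded_linear_vec_nth]
        test_function_Ck[OF test_function_derivative[OF \<psi>]])
  then show "smooth (div_smooth \<psi>)" by (simp add: smooth_def div_smooth_def[abs_def])
qed (simp add: div_smooth_def test_function_derivative_zero[OF \<psi>])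

section \<open>Integration by parts against Lipschitz functions\<close>

lemma integral_lebesgue_translation:
  fixes f :: "'a::euclidean_space \<Rightarrow> real"
  assumes "continuous_on UNIV f"
  shows "(LINT x|lebesgue. f (x + c)) = (LINT x|lebesgue. f x)"
proof -
  have [measurable]: "f \<in> borel_measurable borel"
    using assms by (rule borel_measurable_continuous_onI)
  have "(LINT x|lebesgue. f (x + c)) = (LINT x|lborel. f (c + x))"
    by (simp add: integral_completion add.commute)
  also have "\<dots> = (LINT x|distr lborel borel ((+) c). f x)"
    by (subst integral_distr) auto
  also have "\<dots> = (LINT x|lebesgue. f x)"
    by (simp add: lborel_distr_plus integral_completion)
  finally show ?thesis .
qed

text \<open>Almost everywhere differentiability would follow from the Lipschitz condition by Rademacher's
  theorem. Assuming it suffices here, because the functions of interest are piecewise smooth.\<close>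

lemma integral_derivative_zero:
  fixes f :: "'a::euclidean_space \<Rightarrow> real"
  assumes lip: "\<And>x y. \<bar>f x - f y\<bar> \<le> C * norm (x - y)"
    and supp: "\<And>x. f x \<noteq> 0 \<Longrightarrow> norm x \<le> R"
    and der: "AE x in lebesgue. (f has_derivative f' x) (at x)"
    and meas: "(\<lambda>x. f' x v) \<in> borel_measurable lebesgue"
  shows "integrable lebesgue (\<lambda>x. f' x v)" and "(LINT x|lebesgue. f' x v) = 0"
proof -
  define t where "t n = 1 / real (Suc n)" for n
  define q where "q n x = (f (x + t n *\<^sub>R v) - f x) / t n" for n x
  have t: "0 < t n" "t n \<le> 1" for n by (simp_all add: t_def)
  have "C-lipschitz_on UNIV f" if "0 \<le> C"
    using lip that by (auto simp: lipschitz_on_def dist_norm)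
  moreover have "0 \<le> C"
    using lip[of "SOME b. b \<in> Basis" 0] norm_some_Basis by (smt (verit) diff_zero mult_cancel_left1)
  ultimately have cont: "continuous_on UNIV f" by (auto intro: lipschitz_on_continuous_on)
  have cont_q: "continuous_on UNIV (q n)" for n
    unfolding q_def using t(1)[of n]
    by (intro continuous_intros continuous_on_compose2[OF cont]) auto
  have dominating: "integrable lebesgue (\<lambda>x. indicator (cball 0 r) x * b)" for r b :: real
    by (intro integrable_mult_left integrable_real_indicator) (use emeasure_lborel_cball_finite in auto)
  have "bounded (f ` cball 0 R)"
    by (intro compact_imp_bounded compact_continuous_image continuous_on_subset[OF cont]) auto
  then obtain B where "\<forall>y\<in>f ` cball 0 R. norm y \<le> B"
    unfolding bounded_iff by (rule exE)
  then have B: "\<bar>f x\<bar> \<le> B" if "norm x \<le> R" for x using that by simp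
  have f_int: "integrable lebesgue f"
  proof (rule Bochner_Integration.integrable_bound[OF dominating[of R B]])
    show "AE x in lebesgue. norm (f x) \<le> norm (indicator (cball 0 R) x * B)"
    proof (rule AE_I2)
      fix x
      show "norm (f x) \<le> norm (indicator (cball 0 R) x * B)"
        using B[of x] supp[of x] by (cases "f x = 0") auto
    qed
  qed (rule continuous_lebesgue_measurable[OF cont])
  \<comment> \<open>As \<open>t n \<le> 1\<close>, all difference quotients vanish outside the ball of radius \<open>K\<close>.\<close>
  define K where "K = R + norm v"
  have bound: "norm (q n x) \<le> indicator (cball 0 K) x * (C * norm v)" for n x
  proof (cases "norm x \<le> K")
    case True
    have "\<bar>f (x + t n *\<^sub>R v) - f x\<bar> \<le> C * norm (t n *\<^sub>R v)"
      using lip[of "x + t n *\<^sub>R v" x] by simp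
    then have "\<bar>q n x\<bar> \<le> C * norm v"
      using t(1)[of n] by (simp add: q_def field_simps)
    then show ?thesis using True by simp
  next
    case False
    have "norm (t n *\<^sub>R v) \<le> norm v" using t[of n] by (simp add: mult_left_le_one_le)
    moreover have "norm x \<le> norm (x + t n *\<^sub>R v) + norm (t n *\<^sub>R v)"
      by (metis add_diff_cancel norm_triangle_ineq4)
    ultimately have "\<not> norm (x + t n *\<^sub>R v) \<le> R" using False by (simp add: K_def)
    moreover have "\<not> norm x \<le> R" using False by (simp add: K_def) (smt (verit) norm_ge_zero)
    ultimately have "f (x + t n *\<^sub>R v) = 0" "f x = 0" using supp by blast+
    then show ?thesis using False by (simp add: q_def)
  qed
  have lim: "AE x in lebesgue. (\<lambda>n. q n x) \<longlonglongrightarrow> f' x v"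
    using der
  proof eventually_elim
    fix x assume D: "(f has_derivative f' x) (at x)"
    have "((\<lambda>s. f (x + s *\<^sub>R v)) has_derivative (\<lambda>s. f' x (s *\<^sub>R v))) (at 0)"
      by (rule has_derivative_compose[where g = f and s = UNIV])
        (use D in \<open>auto intro!: derivative_eq_intros\<close>)
    moreover have "(\<lambda>s. f' x (s *\<^sub>R v)) = (*) (f' x v)"
      by (simp add: fun_eq_iff linear_scale[OF has_derivative_linear[OF D]])
    ultimately have "((\<lambda>s. f (x + s *\<^sub>R v)) has_field_derivative f' x v) (at 0)"
      by (simp add: has_field_derivative_def)
    then have "((\<lambda>h. (f (x + h *\<^sub>R v) - f x) / h) \<longlongrightarrow> f' x v) (at 0)"
      by (simp add: DERIV_def)
    moreover have "filterlim t (at 0) sequentially"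
      unfolding t_def filterlim_at using LIMSEQ_Suc[OF lim_inverse_n] by (simp add: inverse_eq_divide)
    ultimately show "(\<lambda>n. q n x) \<longlonglongrightarrow> f' x v"
      unfolding q_def by (rule filterlim_compose)
  qed
  show "integrable lebesgue (\<lambda>x. f' x v)"
    by (rule integrable_dominated_convergence[OF meas continuous_lebesgue_measurable[OF cont_q] dominating lim])
      (use bound in auto)
  have "(\<lambda>n. LINT x|lebesgue. q n x) \<longlonglongrightarrow> (LINT x|lebesgue. f' x v)"
    by (rule integral_dominated_convergence[OF meas continuous_lebesgue_measurable[OF cont_q] dominating lim])
      (use bound in auto)
  moreover have "(LINT x|lebesgue. q n x) = 0" for n
  proof -
    \<comment> \<open>The translate of \<open>f\<close> is integrable, being \<open>f + t n * q n\<close>.\<close>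
    have "integrable lebesgue (q n)"
      by (rule integrable_dominated_convergence2[OF meas continuous_lebesgue_measurable[OF cont_q] dominating lim])
        (use bound in auto)
    then have "integrable lebesgue (\<lambda>x. f x + t n * q n x)" using f_int by simp
    then have "integrable lebesgue (\<lambda>x. f (x + t n *\<^sub>R v))" using t(1)[of n] by (simp add: q_def)
    then show ?thesis using f_int
      by (simp add: q_def integral_lebesgue_translation[OF cont])
  qed
  ultimately show "(LINT x|lebesgue. f' x v) = 0"
    by (simp add: LIMSEQ_const_iff)
qed

text \<open>The function \<open>w\<close> need not vanish near the boundary of \<open>S\<close>, since \<open>\<psi>\<close> does; \<open>W\<close> is its almost
  everywhere gradient.\<close>

lemma integral_by_parts:
  fixes \<psi> :: "real^'n \<Rightarrow> real^'n" and w :: "real^'n \<Rightarrow> real"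
  assumes S: "S \<in> lmeasurable" and \<psi>: "\<psi> \<in> test_functions S"
    and lip: "\<And>x y. \<bar>w x - w y\<bar> \<le> C * norm (x - y)"
    and bw: "\<And>x. \<bar>w x\<bar> \<le> B" and bW: "\<And>x. norm (W x) \<le> B'"
    and der: "AE x in lebesgue. (w has_derivative (\<lambda>v. W x \<bullet> v)) (at x)"
    and mw: "w \<in> borel_measurable lebesgue" and mW: "W \<in> borel_measurable lebesgue"
  shows "(LINT x|lebesgue_on S. \<psi> x \<bullet> W x) = - (LINT x|lebesgue_on S. div_smooth \<psi> x * w x)"
proof -
  define D where "D j x = frechet_derivative \<psi> (at x) (axis j 1) $ j * w x + \<psi> x $ j * W x $ j"
    for j x
  obtain M where M: "\<And>x. norm (\<psi> x) \<le> M" using test_function_bounded[OF \<psi>] by metis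
  obtain L where L: "\<And>x y. norm (\<psi> x - \<psi> y) \<le> L * norm (x - y)"
    using test_function_Lipschitz[OF \<psi>] by metis
  obtain R where R: "\<And>x. \<psi> x \<noteq> 0 \<Longrightarrow> norm x \<le> R"
    using test_function_support_bounded[OF \<psi>] by metis
  \<comment> \<open>Off a null set, \<open>D j\<close> is the derivative of \<open>\<psi>\<^sub>j * w\<close> in direction \<open>axis j 1\<close>.\<close>
  have D: "integrable lebesgue (D j)" "(LINT x|lebesgue. D j x) = 0" for j
  proof -
    define f where "f x = \<psi> x $ j * w x" for x
    define f' where "f' x v = frechet_derivative \<psi> (at x) v $ j * w x + \<psi> x $ j * (W x \<bullet> v)" for x v
    have D_eq: "D j = (\<lambda>x. f' x (axis j 1))"
      by (simp add: D_def f'_def inner_axis fun_eq_iff)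
    have 1: "\<bar>f x - f y\<bar> \<le> (M * C + B * L) * norm (x - y)" for x y
    proof -
      have "f x - f y = \<psi> x $ j * (w x - w y) + w y * (\<psi> x - \<psi> y) $ j"
        by (simp add: f_def algebra_simps)
      also have "\<bar>\<dots>\<bar> \<le> \<bar>\<psi> x $ j\<bar> * \<bar>w x - w y\<bar> + \<bar>w y\<bar> * \<bar>(\<psi> x - \<psi> y) $ j\<bar>"
        by (metis abs_mult abs_triangle_ineq)
      also have "\<dots> \<le> M * (C * norm (x - y)) + B * (L * norm (x - y))"
        using bw[of y] M[of x]
        by (intro add_mono mult_mono lip order_trans[OF component_le_norm_cart M]
            order_trans[OF component_le_norm_cart L] bw)
          (auto intro: order_trans[OF abs_ge_zero] order_trans[OF norm_ge_zero])
      finally show ?thesis by (simp add: algebra_simps)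
    qed
    have 2: "norm x \<le> R" if "f x \<noteq> 0" for x
      using R[of x] that by (cases "\<psi> x = 0") (auto simp: f_def)
    have 3: "AE x in lebesgue. (f has_derivative f' x) (at x)"
      using der
    proof eventually_elim
      fix x assume w: "(w has_derivative (\<lambda>v. W x \<bullet> v)) (at x)"
      have "((\<lambda>x. \<psi> x $ j) has_derivative (\<lambda>v. frechet_derivative \<psi> (at x) v $ j)) (at x)"
        by (rule bounded_linear.has_derivative[OF bounded_linear_vec_nth
              test_function_has_derivative[OF \<psi>]])
      from has_derivative_mult[OF this w] show "(f has_derivative f' x) (at x)"
        by (simp add: f_def[abs_def] f'_def[abs_def] add.commute)
    qed
    have 4: "(\<lambda>x. f' x (axis j 1)) \<in> borel_measurable lebesgue"
      unfolding f'_def by (simp add: cart_eq_inner_axis mw borel_measurable_times borel_measurable_add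
          borel_measurable_inner mW test_function_measurable[OF \<psi>]
          test_function_measurable[OF test_function_derivative[OF \<psi>]])
    show "integrable lebesgue (D j)" "(LINT x|lebesgue. D j x) = 0"
      unfolding D_eq using integral_derivative_zero[OF 1 2 3 4] by auto
  qed
  have sum_D: "(\<Sum>j\<in>UNIV. D j x) = div_smooth \<psi> x * w x + \<psi> x \<bullet> W x" for x
    by (simp add: D_def div_smooth_def sum.distrib sum_distrib_right inner_vec_def)
  have zero: "div_smooth \<psi> x * w x + \<psi> x \<bullet> W x = 0" if "x \<notin> S" for x
    using that test_function_zero[OF \<psi>] test_function_zero[OF div_smooth_test_function[OF \<psi>]] by simp
  have "(LINT x|lebesgue_on S. div_smooth \<psi> x * w x + \<psi> x \<bullet> W x)
      = (LINT x|lebesgue. indicator S x *\<^sub>R (div_smooth \<psi> x * w x + \<psi> x \<bullet> W x))"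
    using S by (intro integral_restrict_space) auto
  also have "\<dots> = (LINT x|lebesgue. (\<Sum>j\<in>UNIV. D j x))"
    unfolding sum_D by (rule Bochner_Integration.integral_cong) (auto simp: indicator_def zero)
  also have "\<dots> = 0" using D by simp
  finally have "(LINT x|lebesgue_on S. div_smooth \<psi> x * w x + \<psi> x \<bullet> W x) = 0" .
  moreover have "integrable (lebesgue_on S) (\<lambda>x. div_smooth \<psi> x * w x)"
    using L2_integrable_inner[OF test_function_L2[OF S div_smooth_test_function[OF \<psi>]]
        bounded_measurable_L2[OF S mw, of B]] bw by simp
  moreover have "integrable (lebesgue_on S) (\<lambda>x. \<psi> x \<bullet> W x)"
    by (rule L2_integrable_inner[OF test_function_L2[OF S \<psi>] bounded_measurable_L2[OF S mW bW]])
  ultimately show ?thesis by simp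
qed

section \<open>The weak divergence\<close>

lemma grad_test_function:
  fixes \<eta> :: "real^'n \<Rightarrow> real"
  assumes \<eta>: "\<eta> \<in> test_functions S"
  shows grad_bounded: "\<exists>B. \<forall>x. norm (grad \<eta> x) \<le> B"
    and grad_measurable: "grad \<eta> \<in> borel_measurable lebesgue"
    and grad_has_derivative: "(\<eta> has_derivative (\<lambda>v. grad \<eta> x \<bullet> v)) (at x)"
proof -
  have D: "frechet_derivative \<eta> (at x) v = grad \<eta> x \<bullet> v" for x v
  proof -
    have lin: "linear (frechet_derivative \<eta> (at x))"
      by (rule has_derivative_linear[OF test_function_has_derivative[OF \<eta>]])
    have "frechet_derivative \<eta> (at x) v = frechet_derivative \<eta> (at x) (\<Sum>j\<in>UNIV. v $ j *s axis j 1)"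
      by (simp add: basis_expansion)
    also have "\<dots> = (\<Sum>j\<in>UNIV. v $ j * frechet_derivative \<eta> (at x) (axis j 1))"
      by (simp add: linear_sum[OF lin] linear_scale[OF lin] scalar_mult_eq_scaleR)
    finally show ?thesis by (simp add: grad_def inner_vec_def mult.commute)
  qed
  show "(\<eta> has_derivative (\<lambda>v. grad \<eta> x \<bullet> v)) (at x)"
    using test_function_has_derivative[OF \<eta>, of x] by (simp add: D[abs_def])
  have "continuous_on UNIV (grad \<eta>)"
    unfolding grad_def
    by (intro continuous_on_vec_lambda test_function_continuous[OF test_function_derivative[OF \<eta>]])
  then show "grad \<eta> \<in> borel_measurable lebesgue"
    by (rule continuous_lebesgue_measurable)
  have "\<exists>B. \<forall>x. norm (frechet_derivative \<eta> (at x) v) \<le> B" for v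
    using test_function_bounded[OF test_function_derivative[OF \<eta>, of v]] by metis
  then obtain B where "\<And>v x. \<bar>frechet_derivative \<eta> (at x) v\<bar> \<le> B v" by (metis real_norm_def)
  then have "norm (grad \<eta> x) \<le> (\<Sum>j\<in>UNIV. B (axis j 1))" for x
    by (intro order_trans[OF norm_le_l1_cart] sum_mono) (simp add: grad_def)
  then show "\<exists>B. \<forall>x. norm (grad \<eta> x) \<le> B" by blast
qed

lemma grad_L2: "S \<in> lmeasurable \<Longrightarrow> \<eta> \<in> test_functions S \<Longrightarrow> grad \<eta> \<in> L2 S"
  using grad_bounded grad_measurable bounded_measurable_L2 by metis

lemma has_weak_div_test_function:
  fixes \<psi> :: "real^'n \<Rightarrow> real^'n"
  assumes S: "S \<in> lmeasurable" and \<psi>: "\<psi> \<in> test_functions S"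
  shows "has_weak_div S \<psi> (div_smooth \<psi>)"
  unfolding has_weak_div_def
proof
  fix \<eta> :: "real^'n \<Rightarrow> real" assume \<eta>: "\<eta> \<in> test_functions S"
  obtain B C B' where "\<And>x. norm (\<eta> x) \<le> B" "\<And>x y. norm (\<eta> x - \<eta> y) \<le> C * norm (x - y)"
    "\<And>x. norm (grad \<eta> x) \<le> B'"
    using test_function_bounded[OF \<eta>] test_function_Lipschitz[OF \<eta>] grad_bounded[OF \<eta>] by metis
  then show "(LINT x|lebesgue_on S. \<psi> x \<bullet> grad \<eta> x) = - (LINT x|lebesgue_on S. div_smooth \<psi> x * \<eta> x)"
    by (intro integral_by_parts[OF S \<psi>, where B = B and C = C and B' = B'])
      (auto intro: grad_measurable[OF \<eta>] test_function_measurable[OF \<eta>] grad_has_derivative[OF \<eta>])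
qed

lemma weak_div_works:
  assumes "\<phi> \<in> D_space S"
  shows "weak_div S \<phi> \<in> L2 S" and "has_weak_div S \<phi> (weak_div S \<phi>)"
proof -
  have "\<exists>g. g \<in> L2 S \<and> has_weak_div S \<phi> g" using assms by (auto simp: D_space_def)
  from someI_ex[OF this] show "weak_div S \<phi> \<in> L2 S" "has_weak_div S \<phi> (weak_div S \<phi>)"
    by (simp_all add: weak_div_def)
qed

lemma has_weak_div_diff:
  fixes \<phi> \<psi> :: "real^'n \<Rightarrow> real^'n"
  assumes S: "S \<in> lmeasurable" and L2: "\<phi> \<in> L2 S" "\<psi> \<in> L2 S" "g \<in> L2 S" "h \<in> L2 S"
    and \<phi>: "has_weak_div S \<phi> g" and \<psi>: "has_weak_div S \<psi> h"
  shows "has_weak_div S (\<lambda>x. \<phi> x - \<psi> x) (\<lambda>x. g x - h x)"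
  unfolding has_weak_div_def
proof
  fix \<eta> :: "real^'n \<Rightarrow> real" assume \<eta>: "\<eta> \<in> test_functions S"
  note int = L2_integrable_inner[OF L2(1) grad_L2[OF S \<eta>]] L2_integrable_inner[OF L2(2) grad_L2[OF S \<eta>]]
    L2_integrable_inner[OF L2(3) test_function_L2[OF S \<eta>]]
    L2_integrable_inner[OF L2(4) test_function_L2[OF S \<eta>]]
  show "(LINT x|lebesgue_on S. (\<phi> x - \<psi> x) \<bullet> grad \<eta> x)
      = - (LINT x|lebesgue_on S. (g x - h x) * \<eta> x)"
    using int \<phi> \<psi> \<eta> by (simp add: has_weak_div_def inner_diff_left left_diff_distrib)
qed

text \<open>This guarantees that the choice operator in \<open>weak_div S (\<lambda>x. \<phi> x - \<psi> x)\<close> returns an actual weak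
  divergence, so that the graph norm in the definition of \<open>D_ring\<close> controls it.\<close>

lemma D_space_diff_test_function:
  assumes S: "S \<in> lmeasurable" and \<phi>: "\<phi> \<in> D_space S" and \<psi>: "\<psi> \<in> test_functions S"
  shows "(\<lambda>x. \<phi> x - \<psi> x) \<in> D_space S"
proof -
  note div_L2 = test_function_L2[OF S div_smooth_test_function[OF \<psi>]]
  have \<phi>_L2: "\<phi> \<in> L2 S" using \<phi> by (simp add: D_space_def)
  have "(\<lambda>x. \<phi> x - \<psi> x) \<in> L2 S"
    using L2_diff_scaled[OF \<phi>_L2 test_function_L2[OF S \<psi>], of 1] by simp
  moreover have "(\<lambda>x. weak_div S \<phi> x - div_smooth \<psi> x) \<in> L2 S"
    using L2_diff_scaled[OF weak_div_works(1)[OF \<phi>] div_L2, of 1] by simp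
  moreover have "has_weak_div S (\<lambda>x. \<phi> x - \<psi> x) (\<lambda>x. weak_div S \<phi> x - div_smooth \<psi> x)"
    by (intro has_weak_div_diff[OF S \<phi>_L2 test_function_L2[OF S \<psi>]] weak_div_works[OF \<phi>] div_L2
        has_weak_div_test_function[OF S \<psi>])
  ultimately show ?thesis by (auto simp: D_space_def)
qed

lemma L2_norm_le_graph_norm:
  "L2_norm S \<phi> \<le> graph_norm S \<phi>" "L2_norm S (weak_div S \<phi>) \<le> graph_norm S \<phi>"
  unfolding graph_norm_def by (auto intro!: real_le_rsqrt)

text \<open>The weak divergence of \<open>\<phi> - \<psi>\<close> is tested with \<open>\<eta> = div \<psi>\<close>.\<close>

lemma div_smooth_le_weak_div_diff:
  assumes S: "S \<in> lmeasurable" and \<phi>: "\<phi> \<in> D_space S"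
    and div0: "AE x in lebesgue_on S. weak_div S \<phi> x = 0" and \<psi>: "\<psi> \<in> test_functions S"
  shows "L2_norm S (div_smooth \<psi>) \<le> L2_norm S (weak_div S (\<lambda>x. \<phi> x - \<psi> x))"
proof -
  define \<eta> where "\<eta> = div_smooth \<psi>"
  define g where "g = weak_div S (\<lambda>x. \<phi> x - \<psi> x)"
  have \<eta>: "\<eta> \<in> test_functions S" unfolding \<eta>_def by (rule div_smooth_test_function[OF \<psi>])
  have \<phi>_L2: "\<phi> \<in> L2 S" using \<phi> by (simp add: D_space_def)
  note g = weak_div_works[OF D_space_diff_test_function[OF S \<phi> \<psi>], folded g_def]
  have "(LINT x|lebesgue_on S. weak_div S \<phi> x * \<eta> x) = (LINT x|lebesgue_on S. 0)"
    using div0 by (intro integral_cong_AE)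
      (use L2_D(1)[OF weak_div_works(1)[OF \<phi>]] L2_D(1)[OF test_function_L2[OF S \<eta>]] in auto)
  then have "(LINT x|lebesgue_on S. \<phi> x \<bullet> grad \<eta> x) = 0"
    using weak_div_works(2)[OF \<phi>] \<eta> by (simp add: has_weak_div_def)
  moreover have "(LINT x|lebesgue_on S. \<psi> x \<bullet> grad \<eta> x) = - (L2_norm S \<eta>)\<^sup>2"
    using has_weak_div_test_function[OF S \<psi>] \<eta>
    by (simp add: has_weak_div_def L2_norm_power2 flip: \<eta>_def) (simp add: power2_eq_square)
  moreover have "(LINT x|lebesgue_on S. (\<phi> x - \<psi> x) \<bullet> grad \<eta> x) = - (LINT x|lebesgue_on S. g x * \<eta> x)"
    using g(2) \<eta> by (simp add: has_weak_div_def)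
  moreover have "(LINT x|lebesgue_on S. (\<phi> x - \<psi> x) \<bullet> grad \<eta> x)
      = (LINT x|lebesgue_on S. \<phi> x \<bullet> grad \<eta> x) - (LINT x|lebesgue_on S. \<psi> x \<bullet> grad \<eta> x)"
    using L2_integrable_inner[OF \<phi>_L2 grad_L2[OF S \<eta>]]
      L2_integrable_inner[OF test_function_L2[OF S \<psi>] grad_L2[OF S \<eta>]]
    by (simp add: inner_diff_left)
  ultimately have "(L2_norm S \<eta>)\<^sup>2 = - (LINT x|lebesgue_on S. g x * \<eta> x)" by simp
  also have "\<dots> \<le> L2_norm S g * L2_norm S \<eta>"
    using L2_Cauchy_Schwarz[OF g(1) test_function_L2[OF S \<eta>]] by simp
  finally have "L2_norm S \<eta> * L2_norm S \<eta> \<le> L2_norm S g * L2_norm S \<eta>"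
    by (simp add: power2_eq_square)
  then show ?thesis
    using L2_norm_nonneg[of S \<eta>] L2_norm_nonneg[of S g] unfolding \<eta>_def[symmetric] g_def[symmetric]
    by (cases "L2_norm S \<eta> = 0") (auto simp: mult_le_cancel_right)
qed

lemma D_ring_0_orthogonal:
  fixes \<phi> :: "real^'n \<Rightarrow> real^'n" and w :: "real^'n \<Rightarrow> real"
  assumes S: "S \<in> lmeasurable" and \<phi>: "\<phi> \<in> D_ring_0 S"
    and lip: "\<And>x y. \<bar>w x - w y\<bar> \<le> C * norm (x - y)"
    and bw: "\<And>x. \<bar>w x\<bar> \<le> B" and bW: "\<And>x. norm (W x) \<le> B'"
    and der: "AE x in lebesgue. (w has_derivative (\<lambda>v. W x \<bullet> v)) (at x)"
    and mw: "w \<in> borel_measurable lebesgue" and mW: "W \<in> borel_measurable lebesgue"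
  shows "(LINT x|lebesgue_on S. \<phi> x \<bullet> W x) = 0"
proof -
  have \<phi>_D: "\<phi> \<in> D_space S" and div0: "AE x in lebesgue_on S. weak_div S \<phi> x = 0"
    using \<phi> by (auto simp: D_ring_0_def D_ring_def)
  have \<phi>_L2: "\<phi> \<in> L2 S" using \<phi>_D by (simp add: D_space_def)
  have w_L2: "w \<in> L2 S" using bounded_measurable_L2[OF S mw, of B] bw by simp
  have W_L2: "W \<in> L2 S" by (rule bounded_measurable_L2[OF S mW bW])
  define N where "N = L2_norm S W + L2_norm S w"
  have bound: "\<bar>LINT x|lebesgue_on S. \<phi> x \<bullet> W x\<bar> \<le> \<epsilon> * N" if \<epsilon>: "\<epsilon> > 0" for \<epsilon>
  proof -
    obtain \<psi> where \<psi>: "\<psi> \<in> test_functions S" and small: "graph_norm S (\<lambda>x. \<phi> x - \<psi> x) < \<epsilon>"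
      using \<phi> \<epsilon> unfolding D_ring_0_def D_ring_def by blast
    note div_L2 = test_function_L2[OF S div_smooth_test_function[OF \<psi>]]
    have diff_L2: "(\<lambda>x. \<phi> x - \<psi> x) \<in> L2 S"
      using L2_diff_scaled[OF \<phi>_L2 test_function_L2[OF S \<psi>], of 1] by simp
    have "(LINT x|lebesgue_on S. \<phi> x \<bullet> W x)
        = (LINT x|lebesgue_on S. (\<phi> x - \<psi> x) \<bullet> W x) + (LINT x|lebesgue_on S. \<psi> x \<bullet> W x)"
      using L2_integrable_inner[OF \<phi>_L2 W_L2] L2_integrable_inner[OF test_function_L2[OF S \<psi>] W_L2]
      by (simp add: inner_diff_left)
    also have "(LINT x|lebesgue_on S. \<psi> x \<bullet> W x) = - (LINT x|lebesgue_on S. div_smooth \<psi> x * w x)"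
      by (rule integral_by_parts[OF S \<psi> lip bw bW der mw mW])
    finally have "\<bar>LINT x|lebesgue_on S. \<phi> x \<bullet> W x\<bar>
        \<le> \<bar>LINT x|lebesgue_on S. (\<phi> x - \<psi> x) \<bullet> W x\<bar> + \<bar>LINT x|lebesgue_on S. div_smooth \<psi> x \<bullet> w x\<bar>"
      by simp
    also have "\<dots> \<le> L2_norm S (\<lambda>x. \<phi> x - \<psi> x) * L2_norm S W + L2_norm S (div_smooth \<psi>) * L2_norm S w"
      by (intro add_mono L2_Cauchy_Schwarz diff_L2 W_L2 w_L2 div_L2)
    also have "\<dots> \<le> \<epsilon> * L2_norm S W + \<epsilon> * L2_norm S w"
      using L2_norm_le_graph_norm[of S "\<lambda>x. \<phi> x - \<psi> x"] div_smooth_le_weak_div_diff[OF S \<phi>_D div0 \<psi>] small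
      by (intro add_mono mult_right_mono) (auto simp: L2_norm_nonneg)
    finally show ?thesis by (simp add: N_def distrib_left)
  qed
  show ?thesis
  proof (rule ccontr)
    assume "(LINT x|lebesgue_on S. \<phi> x \<bullet> W x) \<noteq> 0"
    then have pos: "0 < \<bar>LINT x|lebesgue_on S. \<phi> x \<bullet> W x\<bar>" (is "0 < ?J") by simp
    have "0 \<le> N" by (simp add: N_def L2_norm_nonneg)
    then have "?J / (2 * (N + 1)) * N < ?J" using pos by (simp add: field_simps add_nonneg_pos)
    then show False using bound[of "?J / (2 * (N + 1))"] pos \<open>0 \<le> N\<close> by simp
  qed
qed

section \<open>Slices\<close>

lemma slice_integral_zero:
  fixes \<phi> :: "real^'n \<Rightarrow> real^'n"
  assumes S: "S \<in> lmeasurable" and \<phi>: "\<phi> \<in> D_ring_0 S" and "\<alpha> < \<beta>"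
  shows "(LINT x|lebesgue_on S. indicator {x. \<alpha> < x $ i \<and> x $ i < \<beta>} x *\<^sub>R \<phi> x $ i) = 0"
proof -
  define w where "w x = max \<alpha> (min \<beta> (x $ i))" for x :: "real^'n"
  define W where "W x = indicator {x. \<alpha> < x $ i \<and> x $ i < \<beta>} x *\<^sub>R (axis i 1 :: real^'n)" for x :: "real^'n"
  have "(LINT x|lebesgue_on S. \<phi> x \<bullet> W x) = 0"
  proof (rule D_ring_0_orthogonal[OF S \<phi>])
    show "\<bar>w x - w y\<bar> \<le> 1 * norm (x - y)" for x y
      using component_le_norm_cart[of "x - y" i] by (simp add: w_def)
    show "\<bar>w x\<bar> \<le> max \<bar>\<alpha>\<bar> \<bar>\<beta>\<bar>" for x
      by (auto simp: w_def)
    show "norm (W x) \<le> 1" for x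
      by (simp add: W_def indicator_def)
    show "w \<in> borel_measurable lebesgue"
      unfolding w_def by (intro continuous_lebesgue_measurable continuous_intros)
    have "{x :: real^'n. \<alpha> < x $ i \<and> x $ i < \<beta>} \<in> sets lebesgue"
      by (intro sets_completionI_sets) simp
    then show "W \<in> borel_measurable lebesgue" unfolding W_def by measurable
    have "negligible {x :: real^'n. x $ i = c}" for c
      unfolding cart_eq_inner_axis
      by (rule negligible_standard_hyperplane) (auto simp: Basis_vec_def)
    then have "negligible ({x. x $ i = \<alpha>} \<union> {x :: real^'n. x $ i = \<beta>})"
      by (intro negligible_Un)
    then have "AE x in lebesgue. x \<notin> {x. x $ i = \<alpha>} \<union> {x :: real^'n. x $ i = \<beta>}"
      by (intro AE_not_in) (simp add: negligible_iff_null_sets)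
    then show "AE x in lebesgue. (w has_derivative (\<lambda>v. W x \<bullet> v)) (at x)"
    proof eventually_elim
      fix x :: "real^'n" assume "x \<notin> {x. x $ i = \<alpha>} \<union> {x. x $ i = \<beta>}"
      then consider "x $ i < \<alpha>" | "\<alpha> < x $ i" "x $ i < \<beta>" | "\<beta> < x $ i" by force
      then show "(w has_derivative (\<lambda>v. W x \<bullet> v)) (at x)"
      proof cases
        case 1
        then have "W x = 0" by (simp add: W_def)
        moreover have "(w has_derivative (\<lambda>v. 0)) (at x)"
          by (rule has_derivative_transform_within_open[OF has_derivative_const[of \<alpha>],
                where s = "{y. y $ i < \<alpha>}"])
            (use 1 \<open>\<alpha> < \<beta>\<close> in \<open>auto simp: w_def intro: open_halfspace_component_lt_cart\<close>)
        ultimately show ?thesis by simp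
      next
        case 2
        then have "W x = axis i 1" by (simp add: W_def)
        moreover have "(w has_derivative (\<lambda>v. v $ i)) (at x)"
          by (rule has_derivative_transform_within_open[OF
                bounded_linear_imp_has_derivative[OF bounded_linear_vec_nth],
                where s = "{y. \<alpha> < y $ i} \<inter> {y. y $ i < \<beta>}"])
            (use 2 in \<open>auto simp: w_def intro!: open_Int
                intro: open_halfspace_component_lt_cart open_halfspace_component_gt_cart\<close>)
        ultimately show ?thesis by (simp add: inner_axis')
      next
        case 3
        then have "W x = 0" by (simp add: W_def)
        moreover have "(w has_derivative (\<lambda>v. 0)) (at x)"
          by (rule has_derivative_transform_within_open[OF has_derivative_const[of \<beta>],
                where s = "{y. \<beta> < y $ i}"])
            (use 3 \<open>\<alpha> < \<beta>\<close> in \<open>auto simp: w_def intro: open_halfspace_component_gt_cart\<close>)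
        ultimately show ?thesis by simp
      qed
    qed
  qed
  then show ?thesis by (simp add: W_def inner_axis)
qed

theorem corollary3:
  fixes \<Omega> :: "(real^3) set" and l :: "real^3" and \<phi> :: "real^3 \<Rightarrow> real^3"
  assumes "open \<Omega>" and "connected \<Omega>" and "bounded \<Omega>"
    and "smallest_box \<Omega> l"
    and "\<phi> \<in> D_ring_0 \<Omega>"
  shows "\<forall>i. \<forall>\<alpha> \<beta>. 0 \<le> \<alpha> \<and> \<alpha> < \<beta> \<and> \<beta> \<le> l $ i \<longrightarrow>
    (\<lambda>x. \<phi> x $ i) \<in> L2_0 {x \<in> \<Omega>. \<alpha> < x $ i \<and> x $ i < \<beta>}"
proof (intro allI impI)
  fix i :: 3 and \<alpha> \<beta> :: real
  assume "0 \<le> \<alpha> \<and> \<alpha> < \<beta> \<and> \<beta> \<le> l $ i"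
  then have "\<alpha> < \<beta>" by simp
  define A where "A = {x :: real^3. \<alpha> < x $ i \<and> x $ i < \<beta>}"
  have S: "\<Omega> \<in> lmeasurable" using assms(1,3) by (intro lmeasurable_open)
  have A: "A \<in> sets lebesgue" unfolding A_def by (intro sets_completionI_sets) simp
  have slice: "{x \<in> \<Omega>. \<alpha> < x $ i \<and> x $ i < \<beta>} = \<Omega> \<inter> A" by (auto simp: A_def)
  have restrict: "lebesgue_on (\<Omega> \<inter> A) = restrict_space (lebesgue_on \<Omega>) A"
    by (simp add: restrict_restrict_space S fmeasurableD A)
  have A': "A \<inter> space (lebesgue_on \<Omega>) \<in> sets (lebesgue_on \<Omega>)"
    using A S by (simp add: sets_restrict_space_iff fmeasurableD)
  have "\<phi> \<in> L2 \<Omega>" using assms(5) by (simp add: D_ring_0_def D_ring_def D_space_def)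
  note \<phi> = L2_D[OF this]
  have meas: "(\<lambda>x. \<phi> x $ i) \<in> borel_measurable (lebesgue_on \<Omega>)"
    using \<phi>(1) by (simp add: cart_eq_inner_axis)
  have "integrable (lebesgue_on \<Omega>) (\<lambda>x. (\<phi> x $ i)\<^sup>2)"
  proof (rule Bochner_Integration.integrable_bound[OF \<phi>(2)])
    show "AE x in lebesgue_on \<Omega>. norm ((\<phi> x $ i)\<^sup>2) \<le> norm ((norm (\<phi> x))\<^sup>2)"
      using component_le_norm_cart[of "\<phi> _" i] by (simp add: abs_le_square_iff[symmetric])
  qed (use meas in measurable)
  then have "integrable (lebesgue_on (\<Omega> \<inter> A)) (\<lambda>x. (\<phi> x $ i)\<^sup>2)"
    unfolding restrict integrable_restrict_space[OF A']
  proof (rule Bochner_Integration.integrable_bound)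
    have "indicator A \<in> borel_measurable (lebesgue_on \<Omega>)"
      using A by (intro measurable_restrict_space1) simp
    then show "(\<lambda>x. indicator A x *\<^sub>R (\<phi> x $ i)\<^sup>2) \<in> borel_measurable (lebesgue_on \<Omega>)"
      using meas by measurable
  qed (auto simp: indicator_def)
  moreover have "(\<lambda>x. \<phi> x $ i) \<in> borel_measurable (lebesgue_on (\<Omega> \<inter> A))"
    unfolding restrict using meas by (rule measurable_restrict_space1)
  moreover have "(LINT x|lebesgue_on (\<Omega> \<inter> A). \<phi> x $ i) = 0"
    unfolding restrict integral_restrict_space[OF A']
    using slice_integral_zero[OF S assms(5) \<open>\<alpha> < \<beta>\<close>] by (simp add: A_def)
  ultimately show "(\<lambda>x. \<phi> x $ i) \<in> L2_0 {x \<in> \<Omega>. \<alpha> < x $ i \<and> x $ i < \<beta>}"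
    unfolding slice by (simp add: L2_0_def L2_def)
qed

end
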